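(* Let $\mathcal{L}\subset\mathbb{S}^3$ be a net of conics of type $B$ or $C$. Then the reciprocal surface $\mathbb{P}\mathcal{L}^{-1}\subset\mathbb{P}^5$ has degree $3$ and is a projection of the Veronese surface from a point on it.
   Context: Everything is over $\mathbb{C}$. $\mathbb{S}^3$ is the $6$-dimensional space of complex symmetric $3\times 3$ matrices, $\mathbb{P}^5=\mathbb{P}\mathbb{S}^3$. A net of conics is a $3$-dimensional linear subspace of $\mathbb{S}^3$. The reciprocal surface $\mathbb{P}\mathcal{L}^{-1}\subset\mathbb{P}^5$ of a net $\mathcal{L}$ containing an invertible matrix is the Zariski closure of $\mathbb{P}(\{A^{-1} \mid A\in\mathcal{L},\ \det A\neq 0\})$. A symmetric matrix $M$ is identified with the quadratic form $(x,y,z)M(x,y,z)^T$; e.g. $2xz$ is the matrix with entries $1$ at positions $(1,3),(3,1)$ and $0$ elsewhere. Two nets are congruent if $\mathcal{L}_2=g^T\mathcal{L}_1 g$ for some $g\in \mathrm{GL}(3,\mathbb{C})$. A net is of type $B$ if it is congruent to the net spanned by $y^2+2xz,\ 2yz,\ -x^2-2y^2-9z^2+2xz$, and of type $C$ if it is congruent to the net spanned by $y^2+2xz,\ 2yz,\ -x^2$. The Veronese surface $V\subset\mathbb{P}^5$ is the image of $\nu:\mathbb{P}^2\to\mathbb{P}\mathbb{S}^3$, $v\mapsto vv^T$. A surface in $\mathbb{P}^5$ is a projection of $V$ from a linear subspace $E\subset\mathbb{P}^5$ (the center) if it is the Zariski closure of the image of $V\setminus E$ under a rational map $\mathbb{P}^5\dashrightarrow\mathbb{P}^5$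 induced by a linear map $\mathbb{C}^6\to\mathbb{C}^6$ whose kernel has projectivization $E$. *)

theory Defs
  imports
    "HOL-Analysis.Analysis"
    "HOL-Library.Function_Algebras"
    "HOL-Computational_Algebra.Polynomial"
begin

section \<open>The space of complex symmetric 3 by 3 matrices\<close>

type_synonym cmat3 = "complex^3^3"

definition cscale :: "complex \<Rightarrow> cmat3 \<Rightarrow> cmat3" where
  "cscale c A = (\<chi> i j. c * A $ i $ j)"

interpretation mat3: vector_space cscale
  by unfold_locales (simp_all add: cscale_def vec_eq_iff algebra_simps)

definition S3 :: "cmat3 set" where
  "S3 = {A. transpose A = A}"

definition quad_form :: "cmat3 \<Rightarrow> complex \<Rightarrow> complex \<Rightarrow> complex \<Rightarrow> complex" where
  "quad_form M x y z = (\<Sum>i\<in>UNIV. \<Sum>j\<in>UNIV. vector [x, y, z] $ i * M $ i $ j * vector [x, y, z] $ j)"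


section \<open>The projective space of \<open>S3\<close>\<close>

text \<open>A projective point is a one-dimensional linear subspace, i.e. a set of matrices; a subset of
  projective space is a set of such lines.\<close>

type_synonym ppoint = "cmat3 set"

definition pt :: "cmat3 \<Rightarrow> ppoint" where
  "pt A = mat3.span {A}"

definition proj :: "cmat3 set \<Rightarrow> ppoint set" where
  "proj W = pt ` (W - {0})"

abbreviation PS3 :: "ppoint set" where
  "PS3 \<equiv> proj S3"

text \<open>Forms of degree \<open>d\<close> on \<open>S3\<close>: as the base field is infinite, polynomials are identified with
  polynomial functions. The six coordinates are the entries at positions \<open>i \<le> j\<close>. (In the
  numeral type 3 the order is \<open>3 = 0 < 1 < 2\<close>, but any linear order selects exactly one
  of the positions \<open>(i, j)\<close> and \<open>(j, i)\<close>.) Only these entries are used, so a form is determined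
  by its restriction to \<open>S3\<close>.\<close>

interpretation fun3: vector_space "\<lambda>(c::complex) (F :: cmat3 \<Rightarrow> complex) A. c * F A"
  by unfold_locales (simp_all add: fun_eq_iff algebra_simps)

definition sym_monomial :: "(3 \<times> 3 \<Rightarrow> nat) \<Rightarrow> cmat3 \<Rightarrow> complex" where
  "sym_monomial \<alpha> A = (\<Prod>(i, j) \<in> {(i, j). i \<le> j}. (A $ i $ j) ^ \<alpha> (i, j))"

definition forms :: "nat \<Rightarrow> (cmat3 \<Rightarrow> complex) set" where
  "forms d = fun3.span {sym_monomial \<alpha> | \<alpha>. (\<Sum>p \<in> {(i, j). i \<le> j}. \<alpha> p) = d}"

definition vanishes_at :: "(cmat3 \<Rightarrow> complex) \<Rightarrow> ppoint \<Rightarrow> bool" where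
  "vanishes_at F p \<longleftrightarrow> (\<forall>A\<in>p. F A = 0)"

definition zariski_closed :: "ppoint set \<Rightarrow> bool" where
  "zariski_closed X \<longleftrightarrow>
     (\<exists>T \<subseteq> (\<Union>d. forms d). X = {p \<in> PS3. \<forall>F\<in>T. vanishes_at F p})"

definition zariski_closure :: "ppoint set \<Rightarrow> ppoint set" where
  "zariski_closure X = zariski_closed hull X"


section \<open>Dimension and degree of projective varieties\<close>

definition vanishing_forms :: "ppoint set \<Rightarrow> nat \<Rightarrow> (cmat3 \<Rightarrow> complex) set" where
  "vanishing_forms X d = {F \<in> forms d. \<forall>p\<in>X. vanishes_at F p}"

text \<open>The dimension of the degree \<open>d\<close> part of the homogeneous coordinate ring; both spaces are
  finite-dimensional.\<close>

definition hilbert_function :: "ppoint set \<Rightarrow> nat \<Rightarrow> nat" where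
  "hilbert_function X d = fun3.dim (forms d) - fun3.dim (vanishing_forms X d)"

definition hilbert_poly :: "ppoint set \<Rightarrow> rat poly" where
  "hilbert_poly X =
     (THE P. \<forall>\<^sub>F d in sequentially. of_nat (hilbert_function X d) = poly P (of_nat d))"

text \<open>Dimension \<open>r\<close> is the degree of the Hilbert polynomial, and the degree is \<open>r!\<close> times its leading
  coefficient. Both are meant for nonempty Zariski closed sets: by the convention
  \<open>degree 0 = 0\<close>, the empty set also gets dimension 0.\<close>

definition variety_dim :: "ppoint set \<Rightarrow> nat" where
  "variety_dim X = degree (hilbert_poly X)"

definition variety_degree :: "ppoint set \<Rightarrow> rat" where
  "variety_degree X = fact (variety_dim X) * lead_coeff (hilbert_poly X)"


section \<open>Nets of conics and reciprocal surfaces\<close>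

definition net_of_conics :: "cmat3 set \<Rightarrow> bool" where
  "net_of_conics L \<longleftrightarrow> mat3.subspace L \<and> L \<subseteq> S3 \<and> mat3.dim L = 3"

definition reciprocal_surface :: "cmat3 set \<Rightarrow> ppoint set" where
  "reciprocal_surface L = zariski_closure (proj {matrix_inv A | A. A \<in> L \<and> det A \<noteq> 0})"

definition congruent_nets :: "cmat3 set \<Rightarrow> cmat3 set \<Rightarrow> bool" where
  "congruent_nets L1 L2 \<longleftrightarrow>
     (\<exists>g :: cmat3. invertible g \<and> L2 = (\<lambda>A. transpose g ** A ** g) ` L1)"

text \<open>The conics \<open>y\<^sup>2 + 2xz\<close>, \<open>2yz\<close>, \<open>-x\<^sup>2 - 2y\<^sup>2 - 9z\<^sup>2 + 2xz\<close> and \<open>-x\<^sup>2\<close>.\<close>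

definition conic_1 :: cmat3 where
  "conic_1 = vector [vector [0, 0, 1], vector [0, 1, 0], vector [1, 0, 0]]"

definition conic_2 :: cmat3 where
  "conic_2 = vector [vector [0, 0, 0], vector [0, 0, 1], vector [0, 1, 0]]"

definition conic_3B :: cmat3 where
  "conic_3B = vector [vector [-1, 0, 1], vector [0, -2, 0], vector [1, 0, -9]]"

definition conic_3C :: cmat3 where
  "conic_3C = vector [vector [-1, 0, 0], vector [0, 0, 0], vector [0, 0, 0]]"

lemma quad_form_conics:
  "quad_form conic_1 x y z = y^2 + 2*x*z"
  "quad_form conic_2 x y z = 2*y*z"
  "quad_form conic_3B x y z = - (x^2) - 2*y^2 - 9*z^2 + 2*x*z"
  "quad_form conic_3C x y z = - (x^2)"
  by (simp_all add: quad_form_def conic_1_def conic_2_def conic_3B_def conic_3C_def sum_3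
      power2_eq_square)

lemma conics_symmetric: "{conic_1, conic_2, conic_3B, conic_3C} \<subseteq> S3"
  by (simp add: S3_def transpose_def vec_eq_iff forall_3
      conic_1_def conic_2_def conic_3B_def conic_3C_def)

definition type_B :: "cmat3 set \<Rightarrow> bool" where
  "type_B L \<longleftrightarrow> congruent_nets (mat3.span {conic_1, conic_2, conic_3B}) L"

definition type_C :: "cmat3 set \<Rightarrow> bool" where
  "type_C L \<longleftrightarrow> congruent_nets (mat3.span {conic_1, conic_2, conic_3C}) L"


section \<open>Projections of the Veronese surface\<close>

definition veronese :: "ppoint set" where
  "veronese = {pt (\<chi> i j. v $ i * v $ j) | v :: complex^3. v \<noteq> 0}"

text \<open>Every linear endomorphism of \<open>S3\<close> is the restriction of a linear endomorphism \<open>T\<close> of the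
  space of all matrices that preserves \<open>S3\<close>; only the restriction of \<open>T\<close> to \<open>S3\<close> matters here.\<close>

definition projection_of_veronese :: "ppoint set \<Rightarrow> ppoint set \<Rightarrow> bool" where
  "projection_of_veronese X E \<longleftrightarrow>
     (\<exists>T. Vector_Spaces.linear cscale cscale T \<and> T ` S3 \<subseteq> S3 \<and>
        E = proj {A \<in> S3. T A = 0} \<and>
        X = zariski_closure {pt (T A) | A. A \<in> S3 \<and> A \<noteq> 0 \<and> pt A \<in> veronese - E})"

end

theory Submission
  imports Defs
begin

text \<open>
  After a linear change of parameters both nets are congruent to a member of one family of matrices
  \<open>M\<close> depending linearly on \<open>v = (u, b, c)\<close>. The entries of the adjugate of \<open>M\<close> span the conics
  \<open>u\<^sup>2, ub, b\<^sup>2, uc, bc\<close>, all conics except \<open>c\<^sup>2\<close>. So the adjugate is a linear function of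
  \<open>v v\<^sup>T\<close> whose kernel on the symmetric matrices is spanned by the Veronese point of \<open>(0, 0, 1)\<close>.
  The determinant is a cubic with leading term \<open>-u\<^sup>3\<close> in \<open>u\<close>, hence forms that vanish
  on the inverses of the invertible matrices of the net vanish on all adjugates; this identifies
  the two closures. Pulling back forms of degree \<open>d\<close> along the parametrization yields the span of the
  monomials of degree \<open>2d\<close> with exponent of \<open>c\<close> at most \<open>d\<close>, and there are
  \<open>(d + 1)(3d + 2) / 2\<close> of them.
\<close>

section \<open>Rank and nullity, and spaces of functions\<close>

text \<open>A basis of the kernel together with lifts of a basis of the image is a basis of
  \<open>S\<close>. The finite span is demanded around \<open>S\<close> alone, because the ambient
  spaces of functions in the application are infinite-dimensional.\<close>

lemma (in vector_space_pair) rank_nullity: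
  assumes f: "Vector_Spaces.linear s1 s2 f" and S: "vs1.subspace S" and T: "S \<subseteq> vs1.span T" "finite T"
  shows "vs1.dim S = vs1.dim {x \<in> S. f x = 0} + vs2.dim (f ` S)"
proof -
  let ?K = "{x \<in> S. f x = 0}"
  note lin = linear_0[OF f] linear_add[OF f] linear_scale[OF f] linear_diff[OF f] linear_sum[OF f]
  obtain BK where BK: "BK \<subseteq> ?K" "vs1.independent BK" "?K \<subseteq> vs1.span BK" "card BK = vs1.dim ?K"
    using vs1.basis_exists by blast
  obtain D where D: "D \<subseteq> f ` S" "vs2.independent D" "f ` S \<subseteq> vs2.span D" "card D = vs2.dim (f ` S)"
    using vs2.basis_exists by blast
  have finK: "finite BK"
    using vs1.independent_span_bound[OF T(2) BK(2)] BK(1) T(1) by blast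
  have "f ` S \<subseteq> vs2.span (f ` T)"
    using T(1) linear_span_image[OF f] by blast
  then have finD: "finite D"
    using vs2.independent_span_bound[OF _ D(2), of "f ` T"] D(1) T(2) by blast
  define g where "g d = (SOME x. x \<in> S \<and> f x = d)" for d
  have g: "g d \<in> S" "f (g d) = d" if "d \<in> D" for d
    using someI_ex[of "\<lambda>x. x \<in> S \<and> f x = d"] that D(1) unfolding g_def by auto
  have inj: "inj_on g D"
    using g by (metis inj_onI)
  have gD0: "f x \<noteq> 0" if "x \<in> g ` D" for x
    using that g vs2.dependent_zero D(2) by auto
  have disj: "BK \<inter> g ` D = {}"
    using gD0 BK(1) by blast
  have f_g: "f ` g ` D = D"
    using g by force
  have "vs1.independent (BK \<union> g ` D)"
  proof (rule vs1.independent_if_scalars_zero)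
    show "finite (BK \<union> g ` D)" using finK finD by simp
    fix u x assume sum: "(\<Sum>x\<in>BK \<union> g ` D. s1 (u x) x) = 0" and x: "x \<in> BK \<union> g ` D"
    have split: "(\<Sum>x\<in>BK. s1 (u x) x) + (\<Sum>x\<in>g ` D. s1 (u x) x) = 0"
      using sum finD by (simp add: sum.union_disjoint[OF finK _ disj])
    \<comment> \<open>Applying \<open>f\<close> kills the kernel part, so the coefficients on the
      lifts vanish first; those on \<open>BK\<close> follow.\<close>
    have "(\<Sum>x\<in>BK. s2 (u x) (f x)) = 0"
      using BK(1) by (intro sum.neutral) auto
    moreover have "(\<Sum>x\<in>BK. s2 (u x) (f x)) + (\<Sum>x\<in>g ` D. s2 (u x) (f x)) = 0"
      using arg_cong[OF split, of f] by (simp add: lin)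
    ultimately have "(\<Sum>d\<in>D. s2 (u (g d)) d) = 0"
      using g by (simp add: sum.reindex[OF inj] o_def)
    then have uD: "u (g d) = 0" if "d \<in> D" for d
      using vs2.independentD[OF D(2) finD subset_refl, of "\<lambda>d. u (g d)"] that by blast
    then have "(\<Sum>x\<in>BK. s1 (u x) x) = 0"
      using split by (simp add: sum.reindex[OF inj])
    then show "u x = 0"
      using vs1.independentD[OF BK(2) finK subset_refl, of u] uD x by blast
  qed
  moreover have "BK \<union> g ` D \<subseteq> S"
    using BK(1) g(1) by auto
  moreover have "S \<subseteq> vs1.span (BK \<union> g ` D)"
  proof
    fix x assume x: "x \<in> S"
    \<comment> \<open>A combination \<open>c\<close> of lifts has the same image as
      \<open>x\<close>, so \<open>x - c\<close> lies in the kernel.\<close>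
    then have "f x \<in> f ` vs1.span (g ` D)"
      using D(3) linear_span_image[OF f, of "g ` D"] f_g by auto
    then obtain c where c: "c \<in> vs1.span (g ` D)" "f x = f c"
      by blast
    have "g ` D \<subseteq> S" using g by auto
    then have "c \<in> S"
      using c(1) vs1.span_minimal[OF _ S] by blast
    then have "x - c \<in> ?K"
      using x c S by (simp add: vs1.subspace_diff lin)
    then have "x - c \<in> vs1.span BK"
      using BK(3) by blast
    then have "(x - c) + c \<in> vs1.span (BK \<union> g ` D)"
      using c(1) by (intro vs1.span_add) (meson Un_upper1 Un_upper2 subsetD vs1.span_mono)+
    then show "x \<in> vs1.span (BK \<union> g ` D)" by simp
  qed
  ultimately have "vs1.dim S = card (BK \<union> g ` D)"
    using vs1.dim_unique by blast
  also have "\<dots> = vs1.dim ?K + vs2.dim (f ` S)"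
    using card_Un_disjoint[OF finK _ disj] finD card_image[OF inj] BK(4) D(4) by simp
  finally show ?thesis .
qed

section \<open>Vector spaces of complex-valued functions and their pointwise products\<close>

interpretation fspace: vector_space "\<lambda>(c::complex) (F :: 'a \<Rightarrow> complex) x. c * F x"
  by unfold_locales (simp_all add: fun_eq_iff algebra_simps)

text \<open>Multiplication is bilinear: fix a generator \<open>s\<close> and run through the span of
  \<open>T\<close>, then run through the span of \<open>S\<close>. This serves both for forms and
  for the monomials in the parameters.\<close>

lemma span_times:
  fixes f g :: "'a \<Rightarrow> complex"
  assumes f: "f \<in> fspace.span S" and g: "g \<in> fspace.span T"
    and ST: "\<And>s t. s \<in> S \<Longrightarrow> t \<in> T \<Longrightarrow> (\<lambda>x. s x * t x) \<in> fspace.span U"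
  shows "(\<lambda>x. f x * g x) \<in> fspace.span U"
proof -
  have *: "(\<lambda>x. s x * g x) \<in> fspace.span U" if s: "s \<in> S" for s
    using g
  proof (induct rule: fspace.span_induct_alt)
    case base
    then show ?case using fspace.span_zero[of U] by (simp add: zero_fun_def)
  next
    case (step c t y)
    have "(\<lambda>x. s x * ((\<lambda>x. c * t x) + y) x) = (\<lambda>x. c * (s x * t x)) + (\<lambda>x. s x * y x)"
      by (auto simp: fun_eq_iff algebra_simps)
    then show ?case
      using fspace.span_add[OF fspace.span_scale[OF ST[OF s step(1)], of c] step(2)] by simp
  qed
  show ?thesis
    using f
  proof (induct rule: fspace.span_induct_alt)
    case base
    then show ?case using fspace.span_zero[of U] by (simp add: zero_fun_def)
  next
    case (step c t y)
    have "(\<lambda>x. ((\<lambda>x. c * t x) + y) x * g x) = (\<lambda>x. c * (t x * g x)) + (\<lambda>x. y x * g x)"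
      by (auto simp: fun_eq_iff algebra_simps)
    then show ?case
      using fspace.span_add[OF fspace.span_scale[OF *[OF step(1)], of c] step(2)] by simp
  qed
qed

text \<open>This lemma and the next three restate closure under the vector space operations for
  abstracted functions, so that explicit expressions can be taken apart by introduction
  rules.\<close>

lemma subspace_fun_add:
  fixes f g :: "'a \<Rightarrow> complex"
  assumes "fspace.subspace V" "f \<in> V" "g \<in> V"
  shows "(\<lambda>x. f x + g x) \<in> V"
  using fspace.subspace_add[OF assms] by (simp add: plus_fun_def)

lemma subspace_fun_scale:
  fixes f :: "'a \<Rightarrow> complex"
  assumes "fspace.subspace V" "f \<in> V"
  shows "(\<lambda>x. c * f x) \<in> V" "(\<lambda>x. f x * c) \<in> V"
  using fspace.subspace_scale[OF assms] by (simp_all add: mult.commute)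

lemma subspace_fun_diff:
  fixes f g :: "'a \<Rightarrow> complex"
  assumes "fspace.subspace V" "f \<in> V" "g \<in> V"
  shows "(\<lambda>x. f x - g x) \<in> V"
  using fspace.subspace_diff[OF assms] by (simp add: fun_diff_def)

lemma subspace_fun_minus:
  fixes f :: "'a \<Rightarrow> complex"
  assumes "fspace.subspace V" "f \<in> V"
  shows "(\<lambda>x. - f x) \<in> V"
  using subspace_fun_scale(1)[OF assms, of "-1"] by simp

lemmas subspace_fun = subspace_fun_add subspace_fun_scale subspace_fun_diff subspace_fun_minus

section \<open>Forms and Zariski closure\<close>

lemma subspace_forms: "fun3.subspace (forms d)"
  by (simp add: forms_def)

lemma forms_times:
  assumes "F \<in> forms a" "G \<in> forms b"
  shows "(\<lambda>A. F A * G A) \<in> forms (a + b)"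
  using assms unfolding forms_def
proof (rule span_times)
  fix s t
  assume "s \<in> {sym_monomial \<alpha> |\<alpha>. (\<Sum>p\<in>{(i, j). i \<le> j}. \<alpha> p) = a}"
    and "t \<in> {sym_monomial \<alpha> |\<alpha>. (\<Sum>p\<in>{(i, j). i \<le> j}. \<alpha> p) = b}"
  then obtain \<alpha> \<beta> where \<alpha>: "s = sym_monomial \<alpha>" "(\<Sum>p\<in>{(i, j). i \<le> j}. \<alpha> p) = a"
    and \<beta>: "t = sym_monomial \<beta>" "(\<Sum>p\<in>{(i, j). i \<le> j}. \<beta> p) = b"
    by blast
  have "(\<lambda>x. s x * t x) = sym_monomial (\<lambda>p. \<alpha> p + \<beta> p)"
    by (auto simp: \<alpha> \<beta> sym_monomial_def fun_eq_iff power_add prod.distrib split_def)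
  moreover have "(\<Sum>p\<in>{(i, j). i \<le> j}. \<alpha> p + \<beta> p) = a + b"
    using \<alpha>(2) \<beta>(2) by (simp add: sum.distrib)
  ultimately show "(\<lambda>x. s x * t x)
      \<in> fun3.span {sym_monomial \<alpha> |\<alpha>. (\<Sum>p\<in>{(i, j). i \<le> j}. \<alpha> p) = a + b}"
    by (intro fun3.span_base) blast
qed

lemma forms_upper_entry:
  assumes "i \<le> j"
  shows "(\<lambda>A. A $ i $ j) \<in> forms 1"
proof -
  let ?\<alpha> = "\<lambda>p. if p = (i, j) then 1 else 0 :: nat"
  have "sym_monomial ?\<alpha> A = A $ i $ j" for A
  proof -
    have "sym_monomial ?\<alpha> A = (\<Prod>p\<in>{(i, j). i \<le> j}. if p = (i, j) then A $ i $ j else 1)"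
      unfolding sym_monomial_def by (intro prod.cong) (auto split: if_splits)
    then show ?thesis using assms by (simp add: prod.delta)
  qed
  then have "(\<lambda>A. A $ i $ j) = sym_monomial ?\<alpha>"
    by (simp add: fun_eq_iff)
  moreover have "(\<Sum>p\<in>{(i, j). i \<le> j}. ?\<alpha> p) = 1"
    using assms by (simp add: sum.delta)
  ultimately show ?thesis
    unfolding forms_def by (intro fun3.span_base) blast
qed

text \<open>A position with \<open>j < i\<close> is not one of the six coordinates; on symmetric
  matrices the mirrored entry replaces it.\<close>

lemma forms_entry: "\<exists>F\<in>forms 1. \<forall>A\<in>S3. F A = A $ i $ j"
proof (cases "i \<le> j")
  case True
  show ?thesis by (rule bexI[OF _ forms_upper_entry[OF True]]) simp
next
  case False
  have "A $ j $ i = A $ i $ j" if "A \<in> S3" for A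
    using that by (auto simp: S3_def transpose_def vec_eq_iff)
  moreover have "j \<le> i" using False by simp
  ultimately show ?thesis by (intro bexI[OF _ forms_upper_entry[of j i]]) simp_all
qed

text \<open>Exponent functions are arbitrary off the six positions, but the monomial only depends on
  their restriction to these, where each exponent is at most \<open>d\<close>.\<close>

lemma forms_finitely_spanned: "\<exists>T. finite T \<and> forms d = fun3.span T"
proof -
  let ?P = "{(i, j). i \<le> j} :: (3 \<times> 3) set"
  let ?T = "{sym_monomial \<alpha> | \<alpha>. (\<Sum>p\<in>?P. \<alpha> p) = d}"
  have "?T \<subseteq> sym_monomial ` (?P \<rightarrow>\<^sub>E {..d})"
  proof
    fix s assume "s \<in> ?T"
    then obtain \<alpha> where \<alpha>: "s = sym_monomial \<alpha>" "(\<Sum>p\<in>?P. \<alpha> p) = d" by blast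
    have "\<alpha> p \<le> d" if "p \<in> ?P" for p
      using member_le_sum[of p ?P \<alpha>] that \<alpha>(2) by simp
    then have "restrict \<alpha> ?P \<in> ?P \<rightarrow>\<^sub>E {..d}" by auto
    moreover have "s = sym_monomial (restrict \<alpha> ?P)"
      unfolding \<alpha>(1) sym_monomial_def by (intro ext prod.cong) auto
    ultimately show "s \<in> sym_monomial ` (?P \<rightarrow>\<^sub>E {..d})" by blast
  qed
  then have "finite ?T"
    by (rule finite_subset) (intro finite_imageI finite_PiE, auto)
  then show ?thesis unfolding forms_def by blast
qed

lemma forms_homogeneous:
  assumes "F \<in> forms d"
  shows "F (cscale c A) = c ^ d * F A"
  using assms unfolding forms_def
proof (induct rule: fun3.span_induct_alt)
  case base
  then show ?case by simp
next
  case (step a s y)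
  then obtain \<alpha> where \<alpha>: "s = sym_monomial \<alpha>" "(\<Sum>p\<in>{(i, j). i \<le> j}. \<alpha> p) = d" by blast
  have "s (cscale c A) = c ^ d * s A"
    unfolding \<alpha>(1) sym_monomial_def \<alpha>(2)[symmetric]
    by (simp add: cscale_def power_mult_distrib prod.distrib power_sum split_def)
  then show ?case using step(2) by (simp add: algebra_simps)
qed

section \<open>Projective points, vanishing of forms, and closures\<close>

lemma pt_eq: "pt A = range (\<lambda>c. cscale c A)"
  by (simp add: pt_def mat3.span_singleton)

lemma vanishes_at_pt:
  assumes "F \<in> forms d"
  shows "vanishes_at F (pt A) \<longleftrightarrow> F A = 0"
proof
  assume "vanishes_at F (pt A)"
  moreover have "A \<in> pt A" by (simp add: pt_def mat3.span_base)
  ultimately show "F A = 0" by (simp add: vanishes_at_def)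
next
  assume "F A = 0"
  then show "vanishes_at F (pt A)"
    using forms_homogeneous[OF assms] by (auto simp: vanishes_at_def pt_eq)
qed

lemma pt_cscale:
  assumes "c \<noteq> 0"
  shows "pt (cscale c A) = pt A"
proof -
  have scale: "cscale (inverse c) (cscale c A) = A"
    using assms by simp
  have "cscale c A \<in> mat3.span {A}"
    by (simp add: mat3.span_scale mat3.span_base)
  moreover have "A \<in> mat3.span {cscale c A}"
    using mat3.span_scale[of "cscale c A" "{cscale c A}" "inverse c"]
    unfolding scale by (simp add: mat3.span_base)
  ultimately show ?thesis
    unfolding pt_def by (intro subset_antisym mat3.span_minimal) simp_all
qed

lemma pt_eq_ptD:
  assumes "pt A = pt B"
  shows "\<exists>c. A = cscale c B"
proof -
  have "A \<in> pt A" by (simp add: pt_def mat3.span_base)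
  then show ?thesis using assms by (auto simp: pt_eq)
qed

text \<open>All forms vanishing on \<open>X\<close> together cut out the smallest closed set around
  it. So two subsets of \<open>PS3\<close> with the same vanishing forms have the same
  closure.\<close>

lemma zariski_closure_eq:
  assumes "X \<subseteq> PS3"
  shows "zariski_closure X =
    {p \<in> PS3. \<forall>d. \<forall>F\<in>vanishing_forms X d. vanishes_at F p}" (is "_ = ?R")
  unfolding zariski_closure_def
proof (rule hull_unique)
  show "X \<subseteq> ?R" using assms by (auto simp: vanishing_forms_def)
  show "zariski_closed ?R"
    unfolding zariski_closed_def
    by (rule exI[of _ "\<Union>d. vanishing_forms X d"]) (auto simp: vanishing_forms_def)
  fix Y assume "X \<subseteq> Y" "zariski_closed Y"
  then obtain T where T: "T \<subseteq> (\<Union>d. forms d)" "Y = {p \<in> PS3. \<forall>F\<in>T. vanishes_at F p}"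
    unfolding zariski_closed_def by blast
  have "\<exists>d. F \<in> vanishing_forms X d" if "F \<in> T" for F
    using T that \<open>X \<subseteq> Y\<close> unfolding vanishing_forms_def by blast
  then show "?R \<subseteq> Y" unfolding T(2) by blast
qed

text \<open>Hence the Hilbert function of a closure can be computed on the set itself.\<close>

lemma vanishing_forms_closure:
  assumes "X \<subseteq> PS3"
  shows "vanishing_forms (zariski_closure X) d = vanishing_forms X d"
proof -
  have "X \<subseteq> zariski_closure X"
    unfolding zariski_closure_def by (rule hull_subset)
  then show ?thesis
    unfolding zariski_closure_eq[OF assms] by (auto simp: vanishing_forms_def)
qed

section \<open>Conics through a point and their powers\<close>

text \<open>The pair \<open>(k, j)\<close> stands for the monomial \<open>u\<^sup>i b\<^sup>j c\<^sup>k\<close> with \<open>i + j + k = 2d\<close>. The products of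
  \<open>d\<close> of the conics \<open>u\<^sup>2\<close>, \<open>ub\<close>, \<open>b\<^sup>2\<close>, \<open>uc\<close>, \<open>bc\<close> through \<open>(0:0:1)\<close> are exactly those with \<open>k \<le> d\<close>.\<close>

definition pmono_exps :: "nat \<Rightarrow> (nat \<times> nat) set" where
  "pmono_exps d = (SIGMA k:{..d}. {..2 * d - k})"

definition pmono :: "nat \<Rightarrow> nat \<times> nat \<Rightarrow> complex^3 \<Rightarrow> complex" where
  "pmono d = (\<lambda>(k, j) v. v $ 1 ^ (2 * d - k - j) * v $ 2 ^ j * v $ 3 ^ k)"

definition pmono_span :: "nat \<Rightarrow> (complex^3 \<Rightarrow> complex) set" where
  "pmono_span d = fspace.span (pmono d ` pmono_exps d)"

lemma subspace_pmono_span: "fspace.subspace (pmono_span d)"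
  by (simp add: pmono_span_def)

lemma pmono_exps_iff: "(k, j) \<in> pmono_exps d \<longleftrightarrow> k \<le> d \<and> k + j \<le> 2 * d"
  by (auto simp: pmono_exps_def)

lemma finite_pmono_exps: "finite (pmono_exps d)"
  by (simp add: pmono_exps_def)

lemma card_pmono_exps: "2 * card (pmono_exps d) = (d + 1) * (3 * d + 2)"
proof -
  \<comment> \<open>The upper limit \<open>n\<close> is separated from \<open>d\<close>, so that the
    summand stays fixed during the induction.\<close>
  have "2 * (\<Sum>k\<le>n. 2 * d - k + 1) = (n + 1) * (4 * d + 2 - n)" if "n \<le> d" for n
    using that
  proof (induct n)
    case (Suc n)
    then obtain e where e: "d = Suc n + e" using le_Suc_ex by blast
    show ?case using Suc by (simp add: e algebra_simps)
  qed simp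
  from this[of d] have "2 * (\<Sum>k\<le>d. 2 * d - k + 1) = (d + 1) * (3 * d + 2)"
    by (simp add: algebra_simps)
  moreover have "card (pmono_exps d) = (\<Sum>k\<le>d. 2 * d - k + 1)"
    by (simp add: pmono_exps_def)
  ultimately show ?thesis by simp
qed

lemma pmono_times:
  assumes "k + j \<le> 2 * a" "k' + j' \<le> 2 * b"
  shows "pmono a (k, j) v * pmono b (k', j') v = pmono (a + b) (k + k', j + j') v"
proof -
  have "2 * (a + b) - (k + k') - (j + j') = (2 * a - k - j) + (2 * b - k' - j')"
    using assms by simp
  then show ?thesis by (simp add: pmono_def power_add)
qed

lemma pmono_span_times:
  assumes "f \<in> pmono_span a" "g \<in> pmono_span b"
  shows "(\<lambda>v. f v * g v) \<in> pmono_span (a + b)"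
  using assms unfolding pmono_span_def
proof (rule span_times)
  fix s t assume "s \<in> pmono a ` pmono_exps a" "t \<in> pmono b ` pmono_exps b"
  then obtain k j k' j' where st: "s = pmono a (k, j)" "t = pmono b (k', j')"
    and kj: "(k, j) \<in> pmono_exps a" "(k', j') \<in> pmono_exps b"
    by auto
  have "(\<lambda>v. s v * t v) = pmono (a + b) (k + k', j + j')"
    using kj by (auto simp: st pmono_times pmono_exps_iff)
  moreover have "(k + k', j + j') \<in> pmono_exps (a + b)"
    using kj by (simp add: pmono_exps_iff)
  ultimately show "(\<lambda>v. s v * t v) \<in> fspace.span (pmono (a + b) ` pmono_exps (a + b))"
    by (simp add: fspace.span_base)
qed

text \<open>On the curve \<open>(1, x, x\<^sup>N)\<close> with \<open>N > 2d\<close> the monomials of degree \<open>2d\<close> restrict to distinct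
  powers of \<open>x\<close>.\<close>

lemma pmono_sum_zero:
  assumes "finite I" and I: "I \<subseteq> pmono_exps d"
    and zero: "\<And>v. (\<Sum>p\<in>I. c p * pmono d p v) = 0" and q: "q \<in> I"
  shows "c q = 0"
proof -
  let ?N = "2 * d + 1"
  let ?e = "\<lambda>(k, j). j + ?N * k"
  \<comment> \<open>As \<open>j \<le> 2 * d < ?N\<close>, the pair \<open>(k, j)\<close> is
    recovered as quotient and remainder of the exponent by \<open>?N\<close>.\<close>
  have inj: "inj_on ?e I"
  proof (rule inj_onI)
    fix p q assume pq: "p \<in> I" "q \<in> I" "?e p = ?e q"
    obtain k j k' j' where kj: "p = (k, j)" "q = (k', j')" by fastforce
    have "(k, j) \<in> pmono_exps d" "(k', j') \<in> pmono_exps d" using pq I kj by auto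
    then have "j < ?N" "j' < ?N" by (auto simp: pmono_exps_iff)
    moreover have eq: "j + ?N * k = j' + ?N * k'" using pq kj by simp
    moreover have "(j + ?N * k) div ?N = k" "(j' + ?N * k') div ?N = k'"
      using \<open>j < ?N\<close> \<open>j' < ?N\<close> by (simp_all only: div_mult_self2 div_less)
    ultimately have "k = k'" by metis
    then show "p = q" using eq kj by simp
  qed
  let ?p = "\<Sum>p\<in>I. monom (c p) (?e p)"
  have "poly ?p x = 0" for x
  proof -
    have "poly ?p x = (\<Sum>p\<in>I. c p * pmono d p (vector [1, x, x ^ ?N]))"
      unfolding poly_sum
      by (intro sum.cong) (auto simp: poly_monom pmono_def power_add power_mult[symmetric] algebra_simps)
    then show ?thesis using zero by simp
  qed
  then have "?p = 0" using poly_all_0_iff_0 by blast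
  then have "0 = (\<Sum>p\<in>I. coeff (monom (c p) (?e p)) (?e q))"
    unfolding coeff_sum[symmetric] by simp
  also have "\<dots> = (\<Sum>p\<in>I. if p = q then c p else 0)"
    using inj q by (intro sum.cong) (auto simp: inj_on_def)
  also have "\<dots> = c q" using q \<open>finite I\<close> by simp
  finally show ?thesis by simp
qed

text \<open>Equal monomials with distinct exponents would satisfy a linear relation with
  coefficients \<open>1\<close> and \<open>-1\<close>.\<close>

lemma inj_pmono: "inj_on (pmono d) (pmono_exps d)"
proof (rule inj_onI, rule ccontr)
  fix p q assume pq: "p \<in> pmono_exps d" "q \<in> pmono_exps d" "pmono d p = pmono d q" "p \<noteq> q"
  have "(if p = p then 1 else -1 :: complex) = 0"
    by (rule pmono_sum_zero[of "{p, q}" d "\<lambda>r. if r = p then 1 else -1"]) (use pq in auto)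
  then show False by simp
qed

lemma sum_apply: "(\<Sum>x\<in>A. f x) v = (\<Sum>x\<in>A. f x v :: 'a::comm_monoid_add)"
  by (induct A rule: infinite_finite_induct) simp_all

lemma independent_pmono: "fspace.independent (pmono d ` pmono_exps d)"
proof (rule fspace.independent_if_scalars_zero)
  fix u x assume sum: "(\<Sum>x\<in>pmono d ` pmono_exps d. (\<lambda>v. u x * x v)) = 0"
    and "x \<in> pmono d ` pmono_exps d"
  then obtain q where q: "q \<in> pmono_exps d" "x = pmono d q" by blast
  have "(\<Sum>p\<in>pmono_exps d. u (pmono d p) * pmono d p v) = 0" for v
    using fun_cong[OF sum, of v] by (simp add: sum.reindex[OF inj_pmono] sum_apply)
  then show "u x = 0"
    using pmono_sum_zero[OF finite_pmono_exps subset_refl, where d = d and c = "\<lambda>p. u (pmono d p)" and q = q] q by simp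
qed (simp add: finite_pmono_exps)

lemma dim_pmono_span: "fspace.dim (pmono_span d) = card (pmono_exps d)"
  unfolding pmono_span_def
  using fspace.dim_span_eq_card_independent[OF independent_pmono] card_image[OF inj_pmono] by simp

section \<open>Restriction to lines, and generation by five conics\<close>

lemma pmono_span_poly:
  assumes "f \<in> pmono_span d"
  shows "\<exists>p. \<forall>x. f (vector [x, b, c]) = poly p x"
  using assms unfolding pmono_span_def
proof (induct rule: fspace.span_induct_alt)
  case base
  show ?case by (rule exI[of _ 0]) simp
next
  case (step a s y)
  then obtain p where p: "\<And>x. y (vector [x, b, c]) = poly p x" by blast
  obtain k j where s: "s = pmono d (k, j)" using step(1) by auto
  show ?case
    by (rule exI[of _ "monom (a * b ^ j * c ^ k) (2 * d - k - j) + p"])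
      (simp add: s p pmono_def poly_monom algebra_simps)
qed

lemma vec3_eq: "v = (vector [v $ 1, v $ 2, v $ 3] :: 'a::zero^3)"
  by (simp add: vec_eq_iff forall_3)

text \<open>For fixed \<open>b\<close> and \<open>c\<close>, \<open>f\<close> is a polynomial in the
  first coordinate whose product with \<open>q\<close> vanishes identically; as \<open>q\<close> is
  nonzero, \<open>f\<close> vanishes on the whole line.\<close>

lemma pmono_span_zero:
  assumes f: "f \<in> pmono_span d"
    and Q: "\<And>b c. \<exists>q. q \<noteq> 0 \<and> (\<forall>x. poly q x \<noteq> 0 \<longrightarrow> f (vector [x, b, c]) = 0)"
  shows "f v = 0"
proof -
  obtain p where p: "\<And>x. f (vector [x, v $ 2, v $ 3]) = poly p x"
    using pmono_span_poly[OF f] by blast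
  obtain q where q: "q \<noteq> 0" "\<And>x. poly q x \<noteq> 0 \<longrightarrow> f (vector [x, v $ 2, v $ 3]) = 0"
    using Q by blast
  have "poly (p * q) x = 0" for x
    using q(2)[of x] p[of x] by auto
  then have "p * q = 0" using poly_all_0_iff_0 by blast
  then have "p = 0" using q(1) by simp
  then show ?thesis using p[of "v $ 1"] vec3_eq[of v] by simp
qed

lemma pmono_span_1:
  "(\<lambda>v. v $ 1 * v $ 1) \<in> pmono_span 1" "(\<lambda>v. v $ 1 * v $ 2) \<in> pmono_span 1"
  "(\<lambda>v. v $ 2 * v $ 2) \<in> pmono_span 1" "(\<lambda>v. v $ 1 * v $ 3) \<in> pmono_span 1"
  "(\<lambda>v. v $ 2 * v $ 3) \<in> pmono_span 1"
proof -
  have *: "pmono 1 (k, j) \<in> pmono_span 1" if "k \<le> 1" "k + j \<le> 2" for k j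
    unfolding pmono_span_def using that by (intro fspace.span_base imageI) (simp add: pmono_exps_iff)
  show "(\<lambda>v. v $ 1 * v $ 1) \<in> pmono_span 1"
    using *[of 0 0] by (simp add: pmono_def power2_eq_square)
  show "(\<lambda>v. v $ 1 * v $ 2) \<in> pmono_span 1"
    using *[of 0 1] by (simp add: pmono_def)
  show "(\<lambda>v. v $ 2 * v $ 2) \<in> pmono_span 1"
    using *[of 0 2] by (simp add: pmono_def power2_eq_square)
  show "(\<lambda>v. v $ 1 * v $ 3) \<in> pmono_span 1"
    using *[of 1 0] by (simp add: pmono_def)
  show "(\<lambda>v. v $ 2 * v $ 3) \<in> pmono_span 1"
    using *[of 1 1] by (simp add: pmono_def)
qed

text \<open>Every monomial of positive degree splits off one of the five conics and leaves an
  admissible monomial of the next lower degree.\<close>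

lemma pmono_span_least:
  assumes V: "\<And>d. fspace.subspace (V d)" and V0: "(\<lambda>v. 1) \<in> V 0"
    and times: "\<And>d f g. f \<in> V 1 \<Longrightarrow> g \<in> V d \<Longrightarrow> (\<lambda>v. f v * g v) \<in> V (Suc d)"
    and gens: "(\<lambda>v. v $ 1 * v $ 1) \<in> V 1" "(\<lambda>v. v $ 1 * v $ 2) \<in> V 1"
      "(\<lambda>v. v $ 2 * v $ 2) \<in> V 1" "(\<lambda>v. v $ 1 * v $ 3) \<in> V 1" "(\<lambda>v. v $ 2 * v $ 3) \<in> V 1"
  shows "pmono_span d \<subseteq> V d"
proof -
  have gen: "pmono 1 (0, 0) \<in> V 1" "pmono 1 (0, 1) \<in> V 1" "pmono 1 (0, 2) \<in> V 1"
    "pmono 1 (1, 0) \<in> V 1" "pmono 1 (1, 1) \<in> V 1"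
    using gens by (simp_all add: pmono_def power2_eq_square)
  have "pmono d (k, j) \<in> V d" if "k \<le> d" "k + j \<le> 2 * d" for k j
    using that
  proof (induct d arbitrary: k j)
    case 0
    then show ?case using V0 by (simp add: pmono_def)
  next
    case (Suc d)
    have split: "pmono (Suc d) (k, j) \<in> V (Suc d)"
      if "pmono 1 (a, b) \<in> V 1" "k = a + k'" "j = b + j'" "a + b \<le> 2" "k' \<le> d" "k' + j' \<le> 2 * d"
      for a b k' j'
    proof -
      have "(\<lambda>v. pmono 1 (a, b) v * pmono d (k', j') v) \<in> V (Suc d)"
        using that by (intro times Suc(1))
      moreover have "(\<lambda>v. pmono 1 (a, b) v * pmono d (k', j') v) = pmono (Suc d) (k, j)"
        using that by (simp add: pmono_times fun_eq_iff)
      ultimately show ?thesis by simp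
    qed
    \<comment> \<open>The split conic must contain \<open>c\<close> whenever \<open>k > 0\<close>,
      since \<open>k = Suc d\<close> would otherwise exceed the bound in degree \<open>d\<close>.
      The cases use \<open>u^2\<close>, \<open>ub\<close>, \<open>b^2\<close>, \<open>uc\<close>,
      \<open>bc\<close> in this order.\<close>
    consider "k = 0" "j = 0" | "k = 0" "j = 1" | "k = 0" "j \<ge> 2" | "k \<ge> 1" "j = 0" | "k \<ge> 1" "j \<ge> 1"
      by linarith
    then show ?case
    proof cases
      case 1
      then show ?thesis using split[OF gen(1), of 0 0] by simp
    next
      case 2
      then show ?thesis using split[OF gen(2), of 0 0] by simp
    next
      case 3
      then show ?thesis using split[OF gen(3), of 0 "j - 2"] Suc(3) by simp
    next
      case 4
      then show ?thesis using split[OF gen(4), of "k - 1" 0] Suc(2) by simp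
    next
      case 5
      then show ?thesis using split[OF gen(5), of "k - 1" "j - 1"] Suc(2,3) by simp
    qed
  qed
  then have "pmono d ` pmono_exps d \<subseteq> V d"
    by (auto simp: pmono_exps_iff)
  then show ?thesis
    unfolding pmono_span_def by (rule fspace.span_minimal[OF _ V])
qed

section \<open>The adjugate parametrization\<close>

text \<open>The Veronese map on representatives.\<close>

definition square :: "complex^3 \<Rightarrow> cmat3" where
  "square v = (\<chi> i j. v $ i * v $ j)"

text \<open>Up to congruence, \<open>t = 3\<close> gives the net of type B in the coordinates
  \<open>(u, b, c)\<close> with \<open>u = a - 2c\<close>, where \<open>a, b, c\<close> are the coefficients of the three conics, and
  \<open>t = 0\<close> gives the net of type C with \<open>u = a\<close>.\<close>

definition net_mat :: "complex \<Rightarrow> complex^3 \<Rightarrow> cmat3" where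
  "net_mat t v = vector [vector [- v $ 3, 0, v $ 1 + t * v $ 3],
                         vector [0, v $ 1, v $ 2],
                         vector [v $ 1 + t * v $ 3, v $ 2, - (t\<^sup>2) * v $ 3]]"

definition net_det :: "complex \<Rightarrow> complex^3 \<Rightarrow> complex" where
  "net_det t v = - (v $ 1 ^ 3) - 2 * t * v $ 3 * v $ 1 ^ 2 + v $ 3 * v $ 2 ^ 2"

text \<open>The adjugate of \<open>net_mat t v\<close> as a linear function of \<open>square v\<close>.\<close>

definition adj_lin :: "complex \<Rightarrow> cmat3 \<Rightarrow> cmat3" where
  "adj_lin t A = vector [vector [- (t\<^sup>2) * A $ 1 $ 3 - A $ 2 $ 2, A $ 1 $ 2 + t * A $ 2 $ 3, - A $ 1 $ 1 - t * A $ 1 $ 3],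
                         vector [A $ 1 $ 2 + t * A $ 2 $ 3, - A $ 1 $ 1 - 2 * t * A $ 1 $ 3, A $ 2 $ 3],
                         vector [- A $ 1 $ 1 - t * A $ 1 $ 3, A $ 2 $ 3, - A $ 1 $ 3]]"

text \<open>The adjugate has no \<open>c^2\<close> term: the member at \<open>(0, 0, 1)\<close> has
  rank one, so all its 2 by 2 minors vanish. This is where the lower right entry
  \<open>- (t^2) c\<close> matters.\<close>

lemma net_mat_adj: "net_mat t v ** adj_lin t (square v) = cscale (net_det t v) (mat 1)"
  and adj_net_mat: "adj_lin t (square v) ** net_mat t v = cscale (net_det t v) (mat 1)"
  by (simp_all add: matrix_matrix_mult_def vec_eq_iff forall_3 sum_3 net_mat_def adj_lin_def
      square_def cscale_def mat_def net_det_def power2_eq_square power3_eq_cube algebra_simps)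

lemma det_net_mat: "det (net_mat t v) = net_det t v"
  by (simp add: det_3 net_mat_def net_det_def power2_eq_square power3_eq_cube algebra_simps)

lemma adj_lin_add: "adj_lin t (A + B) = adj_lin t A + adj_lin t B"
  and adj_lin_scale: "adj_lin t (cscale c A) = cscale c (adj_lin t A)"
  by (simp_all add: vec_eq_iff forall_3 adj_lin_def cscale_def algebra_simps)

lemma transpose_adj_lin: "transpose (adj_lin t A) = adj_lin t A"
  by (simp add: vec_eq_iff forall_3 adj_lin_def transpose_def)

lemma cscale_mult: "cscale c A ** B = cscale c (A ** B)" "A ** cscale c B = cscale c (A ** B)"
  by (simp_all add: matrix_matrix_mult_def vec_eq_iff cscale_def sum_distrib_left algebra_simps)

text \<open>For \<open>h\<close> inverse to \<open>g\<close>, this is the adjugate of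
  \<open>transpose g ** M ** g\<close> up to the factor \<open>(det g)^2\<close>, where
  \<open>M\<close> is the net matrix whose adjugate is \<open>adj_lin t A\<close>.\<close>

definition adj_cong :: "complex \<Rightarrow> cmat3 \<Rightarrow> cmat3 \<Rightarrow> cmat3" where
  "adj_cong t h A = h ** adj_lin t A ** transpose h"

lemma cmat3_add_rdistrib: "(A + B) ** C = A ** C + B ** (C :: cmat3)"
  by (simp add: matrix_matrix_mult_def vec_eq_iff sum.distrib distrib_right)

lemma adj_cong_add: "adj_cong t h (A + B) = adj_cong t h A + adj_cong t h B"
  and adj_cong_scale: "adj_cong t h (cscale c A) = cscale c (adj_cong t h A)"
  by (simp_all add: adj_cong_def adj_lin_add adj_lin_scale cscale_mult
      matrix_add_ldistrib cmat3_add_rdistrib)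

lemma adj_cong_S3: "adj_cong t h A \<in> S3"
  by (simp add: S3_def adj_cong_def matrix_transpose_mul transpose_adj_lin matrix_mul_assoc)

lemma square_S3: "square v \<in> S3"
  by (simp add: S3_def square_def transpose_def vec_eq_iff)

lemma square_eq_0_iff: "square v = 0 \<longleftrightarrow> v = 0"
  by (auto simp: square_def vec_eq_iff)

lemma adj_cong_inverse:
  assumes "g ** h = mat 1"
  shows "g ** adj_cong t h A ** transpose g = adj_lin t A"
proof -
  have "transpose h ** transpose g = mat 1"
    using assms by (metis matrix_transpose_mul transpose_mat)
  moreover have "g ** adj_cong t h A ** transpose g
      = (g ** h) ** adj_lin t A ** (transpose h ** transpose g)"
    by (simp add: adj_cong_def matrix_mul_assoc)
  ultimately show ?thesis using assms by simp
qed

lemma adj_cong_eq_0: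
  assumes "g ** h = mat 1" "A \<in> S3"
  shows "adj_cong t h A = 0 \<longleftrightarrow> A = cscale (A $ 3 $ 3) (square (axis 3 1))"
proof
  have sym: "A $ i $ j = A $ j $ i" for i j
    using assms(2) by (auto simp: S3_def transpose_def vec_eq_iff)
  assume "adj_cong t h A = 0"
  then have "adj_lin t A = 0"
    using adj_cong_inverse[OF assms(1), of t A] by simp
  \<comment> \<open>The system is triangular: the last column yields \<open>A $ 1 $ 3\<close>,
    \<open>A $ 2 $ 3\<close> and \<open>A $ 1 $ 1\<close>, and then the positions
    \<open>(1, 2)\<close> and \<open>(1, 1)\<close> yield \<open>A $ 1 $ 2\<close> and
    \<open>A $ 2 $ 2\<close>.\<close>
  then have "A $ 1 $ 3 = 0 \<and> A $ 2 $ 3 = 0 \<and> A $ 1 $ 1 = 0 \<and> A $ 1 $ 2 = 0 \<and> A $ 2 $ 2 = 0"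
    by (auto simp: adj_lin_def vec_eq_iff forall_3)
  then show "A = cscale (A $ 3 $ 3) (square (axis 3 1))"
    using sym[of 2 1] sym[of 3 1] sym[of 3 2]
    by (simp add: vec_eq_iff forall_3 cscale_def square_def axis_def)
next
  assume "A = cscale (A $ 3 $ 3) (square (axis 3 1))"
  then obtain c where A: "A = cscale c (square (axis 3 1))" by blast
  have "adj_lin t (square (axis 3 1)) = 0"
    by (simp add: vec_eq_iff forall_3 adj_lin_def square_def axis_def)
  then show "adj_cong t h A = 0"
    unfolding A adj_cong_scale by (simp add: adj_cong_def)
qed

lemma cmat3_congruence_entry:
  fixes g A :: cmat3
  shows "(g ** A ** transpose g) $ i $ j = (\<Sum>k\<in>UNIV. \<Sum>l\<in>UNIV. g $ i $ k * g $ j $ l * A $ k $ l)"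
  by (simp add: matrix_matrix_mult_def transpose_def sum_3 algebra_simps)

lemma subspace_congruence_entry:
  fixes g :: cmat3 and M :: "complex^3 \<Rightarrow> cmat3"
  assumes V: "fspace.subspace V" and M: "\<And>k l. (\<lambda>v. M v $ k $ l) \<in> V"
  shows "(\<lambda>v. (g ** M v ** transpose g) $ i $ j) \<in> V"
  unfolding cmat3_congruence_entry sum_3
  by (intro subspace_fun_add[OF V] subspace_fun_scale(1)[OF V] M)

lemma adj_lin_entry:
  "(\<lambda>v. adj_lin t (square v) $ i $ j) \<in> pmono_span 1"
proof -
  note V = subspace_pmono_span[of 1]
  note m = pmono_span_1 subspace_fun[OF V]
  have "\<forall>i j. (\<lambda>v. adj_lin t (square v) $ i $ j) \<in> pmono_span 1"
    unfolding forall_3 adj_lin_def square_def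
    by (simp only: vector_3 vec_lambda_beta) (intro conjI m)
  then show ?thesis by blast
qed

text \<open>Solving the same triangular system recovers the five conics from the entries of the
  adjugate.\<close>

lemma square_from_adj_lin:
  fixes v :: "complex^3" and t :: complex
  defines "A \<equiv> adj_lin t (square v)"
  shows "v $ 1 * v $ 1 = t * A $ 3 $ 3 - A $ 1 $ 3" "v $ 1 * v $ 2 = A $ 1 $ 2 - t * A $ 2 $ 3"
    "v $ 2 * v $ 2 = t\<^sup>2 * A $ 3 $ 3 - A $ 1 $ 1"
    "v $ 1 * v $ 3 = - A $ 3 $ 3" "v $ 2 * v $ 3 = A $ 2 $ 3"
  by (simp_all add: A_def adj_lin_def square_def algebra_simps)

text \<open>Entries pull back into degree one, and products of spans stay in the spans. Conversely,
  the pullbacks form a graded family closed under products that contains the five conics.\<close>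

lemma pullback_forms:
  assumes "g ** h = mat 1"
  shows "(\<lambda>F v. F (adj_cong t h (square v))) ` forms d = pmono_span d"
    (is "?pull ` _ = _")
proof
  have lin: "Vector_Spaces.linear (\<lambda>c (F :: cmat3 \<Rightarrow> complex) A. c * F A) (\<lambda>c F x. c * F x) ?pull"
    by unfold_locales (auto simp: fun_eq_iff algebra_simps)
  interpret pull: Vector_Spaces.linear "\<lambda>c (F :: cmat3 \<Rightarrow> complex) A. c * F A"
    "\<lambda>c F (x :: complex^3). c * F x" ?pull by (rule lin)
  have entry: "(\<lambda>v. adj_cong t h (square v) $ i $ j) \<in> pmono_span 1" for i j
    unfolding adj_cong_def
    by (intro subspace_congruence_entry subspace_pmono_span adj_lin_entry)
  have one: "(\<lambda>v. 1) \<in> pmono_span 0"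
  proof -
    have "pmono 0 (0, 0) \<in> pmono_span 0"
      unfolding pmono_span_def by (intro fspace.span_base imageI) (simp add: pmono_exps_iff)
    then show ?thesis by (simp add: pmono_def)
  qed
  have power: "(\<lambda>v. f v ^ n) \<in> pmono_span n" if "f \<in> pmono_span 1" for f n
    using pmono_span_times[OF that] by (induct n) (use one in auto)
  have prod: "(\<lambda>v. \<Prod>p\<in>P. f p v ^ \<alpha> p) \<in> pmono_span (\<Sum>p\<in>P. \<alpha> p)"
    if "finite P" "\<And>p. f p \<in> pmono_span 1" for f and \<alpha> :: "3 \<times> 3 \<Rightarrow> nat" and P
    using that(1)
    by induct (use one pmono_span_times power[OF that(2)] in auto)
  have "?pull (sym_monomial \<alpha>) \<in> pmono_span (\<Sum>p\<in>{(i, j). i \<le> j}. \<alpha> p)" for \<alpha>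
  proof -
    have "?pull (sym_monomial \<alpha>)
        = (\<lambda>v. \<Prod>p\<in>{(i, j). i \<le> j}. (adj_cong t h (square v) $ fst p $ snd p) ^ \<alpha> p)"
      by (simp add: sym_monomial_def split_def)
    then show ?thesis
      using prod[of "{(i, j). i \<le> j}" "\<lambda>p v. adj_cong t h (square v) $ fst p $ snd p" \<alpha>] entry
      by simp
  qed
  then show "?pull ` forms d \<subseteq> pmono_span d"
    unfolding forms_def pull.span_image[symmetric]
    by (intro fspace.span_minimal subspace_pmono_span) auto
  let ?V = "\<lambda>d. ?pull ` forms d"
  have V: "fspace.subspace (?V d)" for d
    by (intro pull.subspace_image subspace_forms)
  have "(\<lambda>v. adj_cong t h (square v) $ i $ j) \<in> ?V 1" for i j
  proof -
    \<comment> \<open>The form agrees with the entry only on \<open>S3\<close>, where all values of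
      \<open>adj_cong\<close> lie.\<close>
    obtain F where F: "F \<in> forms 1" "\<forall>A\<in>S3. F A = A $ i $ j" using forms_entry by blast
    then have "?pull F = (\<lambda>v. adj_cong t h (square v) $ i $ j)" by (simp add: adj_cong_S3)
    then show ?thesis using F(1) by (metis imageI)
  qed
  \<comment> \<open>Congruence by \<open>g\<close> undoes \<open>h\<close>, so entries of
    \<open>adj_lin\<close> are combinations of those of \<open>adj_cong\<close>.\<close>
  then have entry': "(\<lambda>v. adj_lin t (square v) $ i $ j) \<in> ?V 1" for i j
    using subspace_congruence_entry[OF V, of "\<lambda>v. adj_cong t h (square v)" 1 g]
    unfolding adj_cong_inverse[OF assms] by blast
  show "pmono_span d \<subseteq> ?V d"
  proof (rule pmono_span_least[where V = ?V])
    have "sym_monomial (\<lambda>_. 0) \<in> forms 0"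
      unfolding forms_def by (intro fun3.span_base) auto
    moreover have "?pull (sym_monomial (\<lambda>_. 0)) = (\<lambda>v. 1)"
      by (simp add: sym_monomial_def split_def)
    ultimately show "(\<lambda>v. 1) \<in> ?V 0" by (metis imageI)
    fix d f f' assume "f \<in> ?V 1" "f' \<in> ?V d"
    then obtain F F' where "F \<in> forms 1" "F' \<in> forms d" "f = ?pull F" "f' = ?pull F'"
      by blast
    then show "(\<lambda>v. f v * f' v) \<in> ?V (Suc d)"
      using forms_times[of F 1 F' d] by (intro image_eqI[of _ _ "\<lambda>A. F A * F' A"]) auto
  next
    note m = entry' subspace_fun[OF V]
    show "(\<lambda>v. v $ 1 * v $ 1) \<in> ?V 1" "(\<lambda>v. v $ 1 * v $ 2) \<in> ?V 1"
      "(\<lambda>v. v $ 2 * v $ 2) \<in> ?V 1" "(\<lambda>v. v $ 1 * v $ 3) \<in> ?V 1" "(\<lambda>v. v $ 2 * v $ 3) \<in> ?V 1"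
      unfolding square_from_adj_lin[where t = t] by (intro m)+
  qed (rule V)
qed

section \<open>Density of the parameters with nonzero determinant\<close>

lemma net_det_eq_poly:
  "net_det t (vector [x, b, c]) = poly [:c * b\<^sup>2, 0, - 2 * t * c, -1:] x"
  by (simp add: net_det_def power2_eq_square power3_eq_cube algebra_simps)

text \<open>For all \<open>b\<close> and \<open>c\<close> the determinant is a cubic in the first
  coordinate with leading coefficient \<open>-1\<close>, so it is a nonzero polynomial on each such
  line.\<close>

lemma form_zero_dense:
  assumes "g ** h = mat 1" "F \<in> forms d"
    and "\<And>v. net_det t v \<noteq> 0 \<Longrightarrow> F (adj_cong t h (square v)) = 0"
  shows "F (adj_cong t h (square v)) = 0"
proof -
  have "(\<lambda>v. F (adj_cong t h (square v))) \<in> pmono_span d"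
    using pullback_forms[OF assms(1)] assms(2) by blast
  moreover have "\<exists>q. q \<noteq> 0 \<and> (\<forall>x. poly q x \<noteq> 0 \<longrightarrow> F (adj_cong t h (square (vector [x, b, c]))) = 0)"
    for b c
  proof (intro exI conjI allI impI)
    show "[:c * b\<^sup>2, 0, - 2 * t * c, -1:] \<noteq> 0" by simp
    fix x assume "poly [:c * b\<^sup>2, 0, - 2 * t * c, -1:] x \<noteq> 0"
    then show "F (adj_cong t h (square (vector [x, b, c]))) = 0"
      by (intro assms(3)) (simp only: net_det_eq_poly not_False_eq_True)
  qed
  ultimately show ?thesis
    using pmono_span_zero[of "\<lambda>v. F (adj_cong t h (square v))"] by blast
qed

lemma adj_cong_square_neq_0:
  assumes "g ** h = mat 1" "v $ 1 \<noteq> 0 \<or> v $ 2 \<noteq> 0"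
  shows "adj_cong t h (square v) \<noteq> 0"
proof
  assume "adj_cong t h (square v) = 0"
  then have "square v = cscale (square v $ 3 $ 3) (square (axis 3 1))"
    using adj_cong_eq_0[OF assms(1) square_S3] by blast
  then have "square v $ i $ i = cscale (square v $ 3 $ 3) (square (axis 3 1)) $ i $ i" for i
    by (rule arg_cong)
  from this[of 1] this[of 2] show False
    using assms(2) by (simp add: square_def cscale_def axis_def)
qed

lemma net_det_neq_0D: "net_det t v \<noteq> 0 \<Longrightarrow> v $ 1 \<noteq> 0 \<or> v $ 2 \<noteq> 0"
  by (auto simp: net_det_def)

text \<open>The predicate \<open>P\<close> lies between a nonzero determinant and avoiding the
  center. Both the inverses of the net and the projected Veronese points are of this kind, hence
  have the same vanishing forms.\<close>

lemma parametrized_set: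
  assumes gh: "g ** h = mat 1" and X: "X = {pt (adj_cong t h (square v)) | v. P v}"
    and P: "\<And>v. net_det t v \<noteq> 0 \<Longrightarrow> P v" "\<And>v. P v \<Longrightarrow> v $ 1 \<noteq> 0 \<or> v $ 2 \<noteq> 0"
  shows "X \<subseteq> PS3"
    and "vanishing_forms X d = {F \<in> forms d. (\<lambda>v. F (adj_cong t h (square v))) = 0}"
proof -
  show "X \<subseteq> PS3"
    using adj_cong_square_neq_0[OF gh] P(2) adj_cong_S3 unfolding X proj_def by blast
  have "(\<forall>p\<in>X. vanishes_at F p) \<longleftrightarrow> (\<lambda>v. F (adj_cong t h (square v))) = 0"
    if F: "F \<in> forms d" for F
  proof -
    have "(\<forall>p\<in>X. vanishes_at F p) \<longleftrightarrow> (\<forall>v. P v \<longrightarrow> F (adj_cong t h (square v)) = 0)"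
      unfolding X using vanishes_at_pt[OF F] by blast
    also have "\<dots> \<longleftrightarrow> (\<forall>v. F (adj_cong t h (square v)) = 0)"
      using form_zero_dense[OF gh F] P(1) by blast
    finally show ?thesis by (simp add: fun_eq_iff)
  qed
  then show "vanishing_forms X d = {F \<in> forms d. (\<lambda>v. F (adj_cong t h (square v))) = 0}"
    by (auto simp: vanishing_forms_def)
qed

section \<open>Dimension and degree\<close>

text \<open>Substituting the parametrization is linear on \<open>forms d\<close>, with the vanishing
  forms as kernel and \<open>pmono_span d\<close> as image.\<close>

lemma hilbert_function_eq:
  assumes gh: "g ** h = mat 1"
    and X: "vanishing_forms X d = {F \<in> forms d. (\<lambda>v. F (adj_cong t h (square v))) = 0}"
  shows "hilbert_function X d = card (pmono_exps d)"
proof -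
  let ?pull = "\<lambda>F v. F (adj_cong t h (square v))"
  interpret vector_space_pair "\<lambda>c (F :: cmat3 \<Rightarrow> complex) A. c * F A"
    "\<lambda>c F (x :: complex^3). c * F x" by unfold_locales
  have lin: "Vector_Spaces.linear (\<lambda>c (F :: cmat3 \<Rightarrow> complex) A. c * F A) (\<lambda>c F x. c * F x) ?pull"
    by unfold_locales (auto simp: fun_eq_iff algebra_simps)
  obtain T where "finite T" "forms d = fun3.span T"
    using forms_finitely_spanned by blast
  then have "fun3.dim (forms d) = fun3.dim (vanishing_forms X d) + fspace.dim (pmono_span d)"
    using rank_nullity[OF lin subspace_forms, of d T] unfolding X pullback_forms[OF gh] by simp
  then show ?thesis
    by (simp add: hilbert_function_def dim_pmono_span)
qed

text \<open>Polynomials that agree at all large integers are equal, so the definite description is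
  determined.\<close>

lemma hilbert_poly_eqI:
  assumes "\<And>d. of_nat (hilbert_function X d) = poly P (of_nat d)"
  shows "hilbert_poly X = P"
  unfolding hilbert_poly_def
proof (rule the_equality)
  show "\<forall>\<^sub>F d in sequentially. of_nat (hilbert_function X d) = poly P (of_nat d)"
    using assms by simp
  fix Q :: "rat poly"
  assume "\<forall>\<^sub>F d in sequentially. of_nat (hilbert_function X d) = poly Q (of_nat d)"
  then obtain N where N: "\<And>d. d \<ge> N \<Longrightarrow> poly P (of_nat d) = poly Q (of_nat d)"
    using assms by (auto simp: eventually_sequentially)
  have "infinite (of_nat ` {N..} :: rat set)"
    by (metis finite_imageD infinite_Ici inj_on_of_nat)
  moreover have "of_nat ` {N..} \<subseteq> {x. poly (Q - P) x = 0}"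
    using N by auto
  ultimately have "infinite {x. poly (Q - P) x = 0}"
    using finite_subset by blast
  then show "Q = P" using poly_roots_finite[of "Q - P"] by auto
qed

lemma dim_degree_of_hilbert_function:
  assumes "\<And>d. hilbert_function X d = card (pmono_exps d)"
  shows "variety_dim X = 2" "variety_degree X = 3"
proof -
  \<comment> \<open>This is \<open>(d + 1) * (3 * d + 2) / 2\<close> expanded; the leading
    coefficient \<open>3/2\<close> times \<open>2!\<close> gives degree 3.\<close>
  have "of_nat (hilbert_function X d) = poly [:1, 5/2, 3/2 :: rat:] (of_nat d)" for d
    using arg_cong[OF card_pmono_exps[of d], of "of_nat :: nat \<Rightarrow> rat"] assms
    by (simp add: algebra_simps)
  then have "hilbert_poly X = [:1, 5/2, 3/2:]" by (rule hilbert_poly_eqI)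
  then show "variety_dim X = 2" "variety_degree X = 3"
    by (simp_all add: variety_dim_def variety_degree_def)
qed

section \<open>The nets of type B and C\<close>

lemma matrix_inv_unique:
  fixes A B :: cmat3
  assumes "A ** B = mat 1" "B ** A = mat 1"
  shows "matrix_inv A = B"
proof -
  have "A ** matrix_inv A = mat 1"
    unfolding matrix_inv_def by (rule someI2[of _ B]) (use assms in auto)
  then show ?thesis by (metis assms(2) matrix_mul_assoc matrix_mul_lid matrix_mul_rid)
qed

lemma matrix_inv_congruence:
  fixes g h M N :: cmat3
  assumes gh: "g ** h = mat 1" "h ** g = mat 1" and MN: "M ** N = mat 1" "N ** M = mat 1"
  shows "matrix_inv (transpose g ** M ** g) = h ** N ** transpose h"
proof (rule matrix_inv_unique)
  have gh': "transpose g ** transpose h = mat 1" "transpose h ** transpose g = mat 1"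
    using gh by (metis matrix_transpose_mul transpose_mat)+
  have "(transpose g ** M ** g) ** (h ** N ** transpose h)
      = transpose g ** (M ** ((g ** h) ** N)) ** transpose h"
    by (simp only: matrix_mul_assoc)
  also have "\<dots> = mat 1" by (simp add: gh gh' MN)
  finally show "(transpose g ** M ** g) ** (h ** N ** transpose h) = mat 1" .
  have "(h ** N ** transpose h) ** (transpose g ** M ** g)
      = h ** (N ** ((transpose h ** transpose g) ** M)) ** g"
    by (simp only: matrix_mul_assoc)
  also have "\<dots> = mat 1" by (simp add: gh gh' MN)
  finally show "(h ** N ** transpose h) ** (transpose g ** M ** g) = mat 1" .
qed

lemma span_conics:
  "mat3.span {conic_1, conic_2, conic_3B} = range (net_mat 3)"
  "mat3.span {conic_1, conic_2, conic_3C} = range (net_mat 0)"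
proof -
  have add: "net_mat t v + net_mat t w = net_mat t (v + w)"
    and scale: "cscale c (net_mat t v) = net_mat t (c *s v)" for t c v w
    by (simp_all add: net_mat_def vec_eq_iff forall_3 cscale_def algebra_simps)
  have sub: "mat3.subspace (range (net_mat t))" for t
  proof (rule mat3.subspaceI)
    show "0 \<in> range (net_mat t)"
      by (rule range_eqI[of _ _ 0]) (simp add: net_mat_def vec_eq_iff forall_3)
  qed (auto simp: add scale)
  \<comment> \<open>The third conic of type B has \<open>a = 0\<close> and \<open>c = 1\<close>, so
    \<open>u = a - 2 * c = -2\<close>. Conversely \<open>a = u + 2 * c\<close> is the coefficient of
    \<open>conic_1\<close> below.\<close>
  have conics: "conic_1 = net_mat t (vector [1, 0, 0])" "conic_2 = net_mat t (vector [0, 1, 0])"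
    "conic_3B = net_mat 3 (vector [-2, 0, 1])" "conic_3C = net_mat 0 (vector [0, 0, 1])" for t
    by (simp_all add: net_mat_def conic_1_def conic_2_def conic_3B_def conic_3C_def)
  have "{conic_1, conic_2, conic_3B} \<subseteq> range (net_mat 3)"
    "{conic_1, conic_2, conic_3C} \<subseteq> range (net_mat 0)"
    using conics by blast+
  then have le: "mat3.span {conic_1, conic_2, conic_3B} \<subseteq> range (net_mat 3)"
    "mat3.span {conic_1, conic_2, conic_3C} \<subseteq> range (net_mat 0)"
    by (simp_all only: mat3.span_minimal[OF _ sub])
  have B: "net_mat 3 v = cscale (v $ 1 + 2 * v $ 3) conic_1 + cscale (v $ 2) conic_2
      + cscale (v $ 3) conic_3B" for v
    by (simp add: net_mat_def conic_1_def conic_2_def conic_3B_def vec_eq_iff forall_3 cscale_def)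
  have C: "net_mat 0 v = cscale (v $ 1) conic_1 + cscale (v $ 2) conic_2
      + cscale (v $ 3) conic_3C" for v
    by (simp add: net_mat_def conic_1_def conic_2_def conic_3C_def vec_eq_iff forall_3 cscale_def)
  have "net_mat 3 v \<in> mat3.span {conic_1, conic_2, conic_3B}"
    "net_mat 0 v \<in> mat3.span {conic_1, conic_2, conic_3C}" for v
    unfolding B C by (intro mat3.span_add mat3.span_scale mat3.span_base; simp)+
  with le show "mat3.span {conic_1, conic_2, conic_3B} = range (net_mat 3)"
    "mat3.span {conic_1, conic_2, conic_3C} = range (net_mat 0)"
    by blast+
qed

lemma type_B_or_C_net:
  assumes "type_B L \<or> type_C L"
  obtains t g h where "g ** h = mat 1" "h ** g = mat 1"
    "L = range (\<lambda>v. transpose g ** net_mat t v ** g)"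
proof -
  obtain t g where "invertible g" "L = (\<lambda>A. transpose g ** A ** g) ` range (net_mat t)"
    using assms unfolding type_B_def type_C_def congruent_nets_def span_conics by blast
  moreover from this(1) obtain h where "g ** h = mat 1" "h ** g = mat 1"
    unfolding invertible_def by blast
  ultimately show ?thesis using that by (simp add: image_image)
qed

text \<open>The inverse is the adjugate divided by the determinant, and this scalar disappears
  projectively.\<close>

lemma proj_inverses_eq:
  assumes gh: "g ** h = mat 1" "h ** g = mat 1"
    and L: "L = range (\<lambda>v. transpose g ** net_mat t v ** g)"
  shows "proj {matrix_inv A | A. A \<in> L \<and> det A \<noteq> 0}
    = {pt (adj_cong t h (square v)) | v. net_det t v \<noteq> 0}"
proof -
  let ?A = "\<lambda>v. transpose g ** net_mat t v ** g"
  have "det g \<noteq> 0" using gh invertible_det_nz invertible_def by blast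
  then have det: "det (?A v) \<noteq> 0 \<longleftrightarrow> net_det t v \<noteq> 0" for v
    by (simp add: det_mul det_transpose det_net_mat)
  have inv: "matrix_inv (?A v) = cscale (inverse (net_det t v)) (adj_cong t h (square v))"
    if "net_det t v \<noteq> 0" for v
  proof -
    have "matrix_inv (?A v) = h ** cscale (inverse (net_det t v)) (adj_lin t (square v)) ** transpose h"
      using that by (intro matrix_inv_congruence gh) (simp_all add: cscale_mult net_mat_adj adj_net_mat)
    then show ?thesis by (simp add: cscale_mult adj_cong_def)
  qed
  \<comment> \<open>\<open>proj\<close> discards the zero matrix, so the inverses have to be seen to
    be nonzero.\<close>
  have nz: "matrix_inv (?A v) \<noteq> 0" if "net_det t v \<noteq> 0" for v
    using adj_cong_square_neq_0[OF gh(1) net_det_neq_0D[OF that], of t] that inv[OF that] by simp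
  have "proj {matrix_inv A | A. A \<in> L \<and> det A \<noteq> 0} = {pt (matrix_inv (?A v)) | v. net_det t v \<noteq> 0}"
  proof -
    have "{matrix_inv A | A. A \<in> L \<and> det A \<noteq> 0} = {matrix_inv (?A v) | v. net_det t v \<noteq> 0}"
      unfolding L using det by blast
    then show ?thesis using nz unfolding proj_def by auto
  qed
  also have "\<dots> = {pt (adj_cong t h (square v)) | v. net_det t v \<noteq> 0}"
  proof -
    have "pt (matrix_inv (?A v)) = pt (adj_cong t h (square v))" if "net_det t v \<noteq> 0" for v
      using that by (simp add: inv pt_cscale)
    then show ?thesis by (metis (no_types, lifting))
  qed
  finally show ?thesis .
qed

section \<open>The Veronese surface and the center of projection\<close>

lemma pt_square_axis_iff:
  assumes "v \<noteq> 0"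
  shows "pt (square v) = pt (square (axis 3 1)) \<longleftrightarrow> v $ 1 = 0 \<and> v $ 2 = 0"
proof
  assume "pt (square v) = pt (square (axis 3 1))"
  then obtain c where "square v = cscale c (square (axis 3 1))"
    using pt_eq_ptD by blast
  then have "square v $ i $ i = cscale c (square (axis 3 1)) $ i $ i" for i
    by (rule arg_cong)
  from this[of 1] this[of 2] show "v $ 1 = 0 \<and> v $ 2 = 0"
    by (simp add: square_def cscale_def axis_def)
next
  assume v: "v $ 1 = 0 \<and> v $ 2 = 0"
  then have "v $ 3 * v $ 3 \<noteq> 0" using assms by (auto simp: vec_eq_iff forall_3)
  moreover have "square v = cscale (v $ 3 * v $ 3) (square (axis 3 1))"
    using v by (simp add: vec_eq_iff forall_3 square_def cscale_def axis_def)
  ultimately show "pt (square v) = pt (square (axis 3 1))"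
    by (simp add: pt_cscale)
qed

lemma veronese_eq: "veronese = {pt (square v) | v. v \<noteq> 0}"
  by (simp add: veronese_def square_def)

text \<open>A representative of a Veronese point is a multiple of some \<open>square v\<close>, and
  the linear map carries the multiple along. Removing the center removes exactly the parameters on
  the third axis.\<close>

lemma projected_points_eq:
  "{pt (adj_cong t h A) | A. A \<in> S3 \<and> A \<noteq> 0 \<and> pt A \<in> veronese - {pt (square (axis 3 1))}}
    = {pt (adj_cong t h (square v)) | v. v $ 1 \<noteq> 0 \<or> v $ 2 \<noteq> 0}" (is "?Y = ?Z")
proof
  show "?Y \<subseteq> ?Z"
  proof
    fix p assume "p \<in> ?Y"
    then obtain A v where A: "p = pt (adj_cong t h A)" "A \<noteq> 0" "pt A = pt (square v)" "v \<noteq> 0"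
      "pt A \<noteq> pt (square (axis 3 1))"
      unfolding veronese_eq by blast
    then obtain c where c: "A = cscale c (square v)" using pt_eq_ptD by blast
    then have "c \<noteq> 0" using A(2) by auto
    then have "p = pt (adj_cong t h (square v))"
      by (simp add: A(1) c adj_cong_scale pt_cscale)
    then show "p \<in> ?Z" using A pt_square_axis_iff[OF A(4)] by auto
  qed
  show "?Z \<subseteq> ?Y"
  proof
    fix p assume "p \<in> ?Z"
    then obtain v where v: "p = pt (adj_cong t h (square v))" "v $ 1 \<noteq> 0 \<or> v $ 2 \<noteq> 0" by blast
    then have "v \<noteq> 0" by auto
    then have "square v \<noteq> 0" "pt (square v) \<in> veronese - {pt (square (axis 3 1))}"
      using pt_square_axis_iff v(2) by (auto simp: square_eq_0_iff veronese_eq)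
    then show "p \<in> ?Y" using v(1) square_S3 by blast
  qed
qed

lemma proj_kernel_eq:
  assumes "g ** h = mat 1"
  shows "proj {A \<in> S3. adj_cong t h A = 0} = {pt (square (axis 3 1))}"
proof -
  let ?E = "square (axis 3 1)"
  have E: "?E \<noteq> 0" by (simp add: square_eq_0_iff)
  have ker: "{A \<in> S3. adj_cong t h A = 0} = range (\<lambda>c. cscale c ?E)"
  proof -
    have "cscale c ?E \<in> S3" for c
      using square_S3[of "axis 3 1"] by (simp add: S3_def transpose_def vec_eq_iff cscale_def)
    moreover have "adj_cong t h ?E = 0"
      by (subst adj_cong_eq_0[OF assms square_S3])
        (simp add: vec_eq_iff forall_3 square_def cscale_def axis_def)
    then have "adj_cong t h (cscale c ?E) = 0" for c
      by (simp add: adj_cong_scale)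
    ultimately show ?thesis
      using adj_cong_eq_0[OF assms] by blast
  qed
  have "pt ?E \<in> proj {A \<in> S3. adj_cong t h A = 0}"
    unfolding proj_def ker using E by (intro imageI DiffI range_eqI[of _ _ 1]) auto
  moreover have "p = pt ?E" if "p \<in> proj {A \<in> S3. adj_cong t h A = 0}" for p
    using that unfolding proj_def ker by (auto intro!: pt_cscale)
  ultimately show ?thesis by blast
qed

theorem proposition3p5:
  fixes L :: "cmat3 set"
  assumes "net_of_conics L"
    and "type_B L \<or> type_C L"
  shows "variety_dim (reciprocal_surface L) = 2 \<and>
         variety_degree (reciprocal_surface L) = 3 \<and>
         (\<exists>p \<in> veronese. projection_of_veronese (reciprocal_surface L) {p})"
proof -
  obtain t g h where gh: "g ** h = mat 1" "h ** g = mat 1"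
    and L: "L = range (\<lambda>v. transpose g ** net_mat t v ** g)"
    using type_B_or_C_net[OF assms(2)] .
  let ?E = "square (axis 3 1)"
  define X where "X = proj {matrix_inv A | A. A \<in> L \<and> det A \<noteq> 0}"
  define Y where "Y = {pt (adj_cong t h A) | A. A \<in> S3 \<and> A \<noteq> 0 \<and> pt A \<in> veronese - {pt ?E}}"
  have X: "X \<subseteq> PS3" "vanishing_forms X d = {F \<in> forms d. (\<lambda>v. F (adj_cong t h (square v))) = 0}" for d
    using parametrized_set[OF gh(1) X_def[unfolded proj_inverses_eq[OF gh L]]] net_det_neq_0D by blast+
  have Y: "Y \<subseteq> PS3" "vanishing_forms Y d = {F \<in> forms d. (\<lambda>v. F (adj_cong t h (square v))) = 0}" for d
    using parametrized_set[OF gh(1) Y_def[unfolded projected_points_eq]] net_det_neq_0D by blast+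
  have closure: "reciprocal_surface L = zariski_closure X"
    by (simp add: reciprocal_surface_def X_def)
  have "hilbert_function (reciprocal_surface L) d = card (pmono_exps d)" for d
    by (rule hilbert_function_eq[OF gh(1)]) (simp add: closure vanishing_forms_closure X)
  note dim_degree_of_hilbert_function[OF this]
  moreover have "projection_of_veronese (reciprocal_surface L) {pt ?E}"
    unfolding projection_of_veronese_def
  proof (intro exI[of _ "adj_cong t h"] conjI)
    show "Vector_Spaces.linear cscale cscale (adj_cong t h)"
      by unfold_locales (simp_all add: adj_cong_add adj_cong_scale)
    show "adj_cong t h ` S3 \<subseteq> S3" using adj_cong_S3 by blast
    show "{pt ?E} = proj {A \<in> S3. adj_cong t h A = 0}"
      by (simp add: proj_kernel_eq[OF gh(1)])
    \<comment> \<open>\<open>X\<close> uses only parameters with nonzero determinant and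
      \<open>Y\<close> all those off the center, but the same forms vanish on both.\<close>
    have "zariski_closure X = zariski_closure Y"
      by (simp add: zariski_closure_eq X Y)
    then show "reciprocal_surface L
        = zariski_closure {pt (adj_cong t h A) | A. A \<in> S3 \<and> A \<noteq> 0 \<and> pt A \<in> veronese - {pt ?E}}"
      unfolding closure Y_def .
  qed
  moreover have "pt ?E \<in> veronese"
    unfolding veronese_eq by (intro CollectI exI[of _ "axis 3 1"]) simp
  ultimately show ?thesis by blast
qed

end
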